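(* Let $m\ge 1$ be an integer and let $X(m)=\left\{\sum_{n=1}^{\infty}\frac{\varepsilon_n}{(2m+2)^n} : \varepsilon_n\in\{0,2,3,\dots,2m+1,2m+3\}\text{ for all } n\ge 1\right\}\subset\mathbb{R}$. Let $X_I(m)$ be the interior of $X(m)$ and $X_C(m)$ the boundary of $X(m)$ in $\mathbb{R}$. Then $X(m)$ is the disjoint union $X(m)=X_I(m)\sqcup X_C(m)$, where $X_I(m)$ is an infinite union of open intervals and has Lebesgue measure equal to $1$, and $X_C(m)$ is a Cantor set with zero Lebesgue measure and fractional Hausdorff dimension $\dim_H X_C(m)=\log_{2m+2}3$.
   Context: The digit set $\{0,2,3,\dots,2m+1,2m+3\}$ consists of $0$, all integers from $2$ to $2m+1$, and $2m+3$. A Cantor set is a set homeomorphic to the Cantor ternary set. "Fractional" means non-integer. *)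

theory Defs
  imports "HOL-Analysis.Analysis"
begin

text \<open>The digit with index \<open>n\<close> below is the digit of weight \<open>b ^ (n + 1)\<close>, so that the
  expansions start right after the radix point.\<close>

definition radix_set :: "nat \<Rightarrow> nat set \<Rightarrow> real set" where
  "radix_set b D = {\<Sum>n. real (\<epsilon> n) / real b ^ Suc n | \<epsilon>. \<forall>n. \<epsilon> n \<in> D}"

definition X :: "nat \<Rightarrow> real set" where
  "X m = radix_set (2 * m + 2) ({0} \<union> {2..2 * m + 1} \<union> {2 * m + 3})"

definition X_I :: "nat \<Rightarrow> real set" where
  "X_I m = interior (X m)"

definition X_C :: "nat \<Rightarrow> real set" where
  "X_C m = frontier (X m)"

definition cantor_ternary_set :: "real set" where
  "cantor_ternary_set = radix_set 3 {0, 2}"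

definition is_cantor_set :: "'a::topological_space set \<Rightarrow> bool" where
  "is_cantor_set S \<longleftrightarrow> S homeomorphic cantor_ternary_set"

text \<open>The gauge \<open>diam(U)\<^sup>s\<close>, with the usual conventions that the empty set contributes \<open>0\<close> and
  that \<open>diam(U)\<^sup>0 = 1\<close> for nonempty \<open>U\<close> (whereas \<open>0 powr 0 = 0\<close> in HOL).\<close>

definition diam_gauge :: "real \<Rightarrow> 'a::metric_space set \<Rightarrow> ennreal" where
  "diam_gauge s U = (if U = {} then 0 else if s = 0 then 1 else ennreal (diameter U powr s))"

text \<open>Boundedness of the covering sets is required explicitly because \<open>diameter\<close> is only
  meaningful for bounded sets. Finite covers are included by padding with empty sets.\<close>

definition hausdorff_premeasure :: "real \<Rightarrow> real \<Rightarrow> 'a::metric_space set \<Rightarrow> ennreal" where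
  "hausdorff_premeasure s \<delta> A =
     (INF U \<in> {U :: nat \<Rightarrow> 'a set. A \<subseteq> (\<Union>i. U i) \<and> (\<forall>i. bounded (U i) \<and> diameter (U i) \<le> \<delta>)}.
        \<Sum>i. diam_gauge s (U i))"

definition hausdorff_measure :: "real \<Rightarrow> 'a::metric_space set \<Rightarrow> ennreal" where
  "hausdorff_measure s A = (SUP \<delta> \<in> {0<..}. hausdorff_premeasure s \<delta> A)"

definition hausdorff_dim :: "'a::metric_space set \<Rightarrow> ennreal" where
  "hausdorff_dim A = Inf {ennreal s | s. 0 \<le> s \<and> hausdorff_measure s A = 0}"

end

theory Submission
  imports Defs
begin

text \<open>Put \<open>b = 2 * m + 2\<close> and write \<open>T\<close> for the set in question. Its digits \<open>0, 2, ..., b - 1, b + 1\<close> form a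
  complete residue system modulo \<open>b\<close>, so the integer translates of \<open>T\<close> cover the line
  (\<open>tile_translates_cover\<close>). As \<open>T\<close> lies in \<open>[0, 2)\<close>, the only translates other than \<open>T\<close> that meet it are
  \<open>T - 1\<close> and \<open>T + 1\<close>.

  The heart of the proof is the identity \<open>T \<inter> (T - 1) = C\<close>, where \<open>C\<close> is the set of numbers with base-\<open>b\<close>
  digits in \<open>{0, 1, 2}\<close> (\<open>tile_overlap\<close>). Comparing the expansions of \<open>x\<close> and \<open>1 + x\<close> digit by digit, the
  difference of the tails is always \<open>1\<close> or \<open>-1\<close>, and exactly three pairs of digits are possible at each
  step. Since \<open>C\<close> is a null set, a point of \<open>T\<close> is a boundary point exactly if it lies in a neighbouring
  translate, so the boundary is \<open>C \<union> (1 + C)\<close> (\<open>frontier_tile\<close>), and \<open>T\<close> has the measure of a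
  fundamental domain, namely \<open>1\<close> (\<open>measure_tile\<close>). Moreover \<open>T\<close> is the closure of its interior; with
  finitely many components of the interior the boundary would be finite
  (\<open>interior_infinite_union_of_intervals\<close>).

  The set \<open>C\<close> is the disjoint union of three copies of itself scaled by \<open>1 / b\<close>, hence homeomorphic to
  the space of ternary sequences, and so is the Cantor ternary set \<open>K\<close> through
  \<open>K = K / 3 \<union> (6 + K) / 9 \<union> (8 + K) / 9\<close>. The dimension \<open>log b 3\<close> is bounded above by covering \<open>C\<close> with its
  \<open>3 ^ n\<close> cylinders of length \<open>b ^ (-n)\<close>, and below by the map that reads digits in base \<open>3\<close>: it sends
  \<open>C\<close> onto \<open>[0, 1]\<close> and is Hoelder continuous with exponent \<open>log b 3\<close> (\<open>matched_hoelder\<close>).\<close>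

section \<open>Radix expansions\<close>

text \<open>The value of the base-\<open>b\<close> expansion with digit sequence \<open>\<epsilon>\<close>; the digit with index \<open>n\<close> has weight
  \<open>b ^ (n + 1)\<close>, and digits are not required to be less than \<open>b\<close>.\<close>

definition radix_val :: "nat \<Rightarrow> (nat \<Rightarrow> nat) \<Rightarrow> real" where
  "radix_val b \<epsilon> = (\<Sum>n. real (\<epsilon> n) / real b ^ Suc n)"

lemma radix_set_iff: "x \<in> radix_set b D \<longleftrightarrow> (\<exists>\<epsilon>. (\<forall>n. \<epsilon> n \<in> D) \<and> x = radix_val b \<epsilon>)"
  by (auto simp: radix_set_def radix_val_def)

lemma summable_digits:
  fixes \<epsilon> :: "nat \<Rightarrow> nat"
  assumes "b \<ge> 2" and "\<And>n. \<epsilon> n \<le> M"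
  shows "summable (\<lambda>n. real (\<epsilon> n) / real b ^ Suc n)"
proof (rule summable_comparison_test')
  show "summable (\<lambda>n. real M * (1 / real b) ^ Suc n)"
    using assms(1) by (intro summable_mult summable_Suc_iff[THEN iffD2] summable_geometric) auto
  show "norm (real (\<epsilon> n) / real b ^ Suc n) \<le> real M * (1 / real b) ^ Suc n" for n
    using assms by (simp add: power_one_over divide_simps)
qed

lemma radix_val_step:
  assumes b: "b \<ge> 2" and "\<And>n. \<epsilon> n \<le> M"
  shows "radix_val b \<epsilon> = (real (\<epsilon> 0) + radix_val b (\<lambda>n. \<epsilon> (Suc n))) / real b"
proof -
  have s: "summable (\<lambda>n. real (\<epsilon> n) / real b ^ Suc n)"
          "summable (\<lambda>n. real (\<epsilon> (Suc n)) / real b ^ Suc n)"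
    by (rule summable_digits[OF b, of _ M], rule assms)+
  have "radix_val b \<epsilon> = real (\<epsilon> 0) / b + (\<Sum>n. real (\<epsilon> (Suc n)) / real b ^ Suc (Suc n))"
    using suminf_split_head[OF s(1)] by (simp add: radix_val_def)
  also have "(\<Sum>n. real (\<epsilon> (Suc n)) / real b ^ Suc (Suc n)) = radix_val b (\<lambda>n. \<epsilon> (Suc n)) / b"
    using suminf_divide[OF s(2), of "real b"] by (simp add: radix_val_def mult.commute)
  finally show ?thesis by (simp add: add_divide_distrib)
qed

text \<open>Coinduction: a bounded set each of whose points can emit a digit in \<open>D\<close> and stay in the set
  consists of numbers with expansions over \<open>D\<close>. After \<open>n\<close> emitted digits the remainder is a point of
  the bounded set scaled by \<open>b ^ (-n)\<close>. Closedness of radix sets, the description of the boundary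
  and surjectivity of ternary expansions onto \<open>[0, 1]\<close> all follow from it.\<close>

lemma radix_set_coinduct:
  assumes b: "b \<ge> 2" and bdd: "bounded Y"
    and step: "\<And>y. y \<in> Y \<Longrightarrow> \<exists>d\<in>D. \<exists>z\<in>Y. y = (real d + z) / real b"
  shows "Y \<subseteq> radix_set b D"
proof
  fix y assume "y \<in> Y"
  obtain dg nx where dn: "\<And>y. y \<in> Y \<Longrightarrow> dg y \<in> D \<and> nx y \<in> Y \<and> y = (real (dg y) + nx y) / real b"
    using step by metis
  define z where "z n = (nx ^^ n) y" for n
  have z: "z n \<in> Y" for n
    by (induction n) (use \<open>y \<in> Y\<close> dn in \<open>auto simp: z_def\<close>)
  define \<epsilon> where "\<epsilon> n = dg (z n)" for n
  have zS: "z n = (real (\<epsilon> n) + z (Suc n)) / real b" for n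
    using dn[OF z[of n]] by (simp add: z_def \<epsilon>_def)
  have part: "(\<Sum>i<n. real (\<epsilon> i) / real b ^ Suc i) = y - z n / real b ^ n" for n
  proof (induction n)
    case (Suc n)
    have "z n / real b ^ n = real (\<epsilon> n) / real b ^ Suc n + z (Suc n) / real b ^ Suc n"
      using b by (subst zS) (simp add: field_simps)
    then show ?case using Suc by simp
  qed (simp add: z_def)
  obtain B where B: "\<And>x. x \<in> Y \<Longrightarrow> \<bar>x\<bar> \<le> B"
    using bdd by (auto simp: bounded_iff)
  have "(\<lambda>n. z n / real b ^ n) \<longlonglongrightarrow> 0"
  proof (rule Lim_null_comparison)
    show "\<forall>\<^sub>F n in sequentially. norm (z n / real b ^ n) \<le> B * (1 / real b) ^ n"
      using B[OF z] b by (intro always_eventually) (simp add: power_one_over divide_simps)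
    show "(\<lambda>n. B * (1 / real b) ^ n) \<longlonglongrightarrow> 0"
      using b by (intro tendsto_mult_right_zero LIMSEQ_power_zero) auto
  qed
  then have "(\<lambda>n. \<Sum>i<n. real (\<epsilon> i) / real b ^ Suc i) \<longlonglongrightarrow> y - 0"
    unfolding part by (intro tendsto_intros)
  then have "(\<lambda>n. real (\<epsilon> n) / real b ^ Suc n) sums y"
    by (simp add: sums_def)
  moreover have "\<epsilon> n \<in> D" for n
    using dn z by (simp add: \<epsilon>_def)
  ultimately show "y \<in> radix_set b D"
    unfolding radix_set_def by (auto simp: sums_iff)
qed

context
  fixes b :: nat and D :: "nat set" and M :: nat
  assumes b: "b \<ge> 2" and D: "D \<subseteq> {..M}"
begin

lemma radix_set_consD:
  assumes "x \<in> radix_set b D"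
  shows "\<exists>d\<in>D. \<exists>y\<in>radix_set b D. x = (real d + y) / real b"
proof -
  obtain \<epsilon> where x: "x = radix_val b \<epsilon>" and \<epsilon>: "\<And>n. \<epsilon> n \<in> D"
    using assms by (auto simp: radix_set_iff)
  have "x = (real (\<epsilon> 0) + radix_val b (\<lambda>n. \<epsilon> (Suc n))) / real b"
    unfolding x by (rule radix_val_step[OF b]) (use \<epsilon> D in blast)
  moreover have "radix_val b (\<lambda>n. \<epsilon> (Suc n)) \<in> radix_set b D"
    unfolding radix_set_iff using \<epsilon> by (intro exI[of _ "\<lambda>n. \<epsilon> (Suc n)"]) simp
  ultimately show ?thesis using \<epsilon> by blast
qed

lemma radix_set_bounds:
  assumes "x \<in> radix_set b D"
  shows "0 \<le> x" and "x \<le> real M / (real b - 1)"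
proof -
  obtain \<epsilon> where x: "x = (\<Sum>n. real (\<epsilon> n) / real b ^ Suc n)" and \<epsilon>: "\<And>n. \<epsilon> n \<in> D"
    using assms by (auto simp: radix_set_def)
  have s: "summable (\<lambda>n. real (\<epsilon> n) / real b ^ Suc n)"
    by (rule summable_digits[OF b, of _ M], use \<epsilon> D in blast)
  show "0 \<le> x" unfolding x using s by (intro suminf_nonneg) auto
  have g: "(\<lambda>n. real M / real b * (1 / real b) ^ n) sums (real M / real b * (1 / (1 - 1 / real b)))"
    using b by (intro sums_mult geometric_sums) auto
  have "x \<le> (\<Sum>n. real M / real b * (1 / real b) ^ n)" unfolding x
  proof (intro suminf_le s)
    show "summable (\<lambda>n. real M / real b * (1 / real b) ^ n)" using g by (rule sums_summable)
    show "real (\<epsilon> n) / real b ^ Suc n \<le> real M / real b * (1 / real b) ^ n" for n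
      using subsetD[OF D \<epsilon>[of n]] b by (simp add: power_one_over field_simps)
  qed
  also have "\<dots> = real M / (real b - 1)"
    using g b by (simp add: sums_iff field_simps)
  finally show "x \<le> real M / (real b - 1)" .
qed

lemma bounded_radix_set: "bounded (radix_set b D)"
  by (rule boundedI[of _ "real M / (real b - 1)"]) (use radix_set_bounds in force)

lemma radix_set_consI:
  assumes "d \<in> D" and "y \<in> radix_set b D"
  shows "(real d + y) / real b \<in> radix_set b D"
proof -
  let ?Y = "insert ((real d + y) / real b) (radix_set b D)"
  have "?Y \<subseteq> radix_set b D"
  proof (rule radix_set_coinduct[OF b])
    fix z assume "z \<in> ?Y"
    then show "\<exists>d\<in>D. \<exists>z'\<in>?Y. z = (real d + z') / real b"
      using assms radix_set_consD[of z] by blast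
  qed (use bounded_radix_set in simp)
  then show ?thesis by blast
qed

lemma radix_set_eq: "radix_set b D = (\<Union>d\<in>D. (\<lambda>x. (real d + x) / real b) ` radix_set b D)"
  using radix_set_consD radix_set_consI by blast

lemma compact_radix_set: "compact (radix_set b D)"
proof -
  let ?R = "radix_set b D" and ?f = "\<lambda>d x. (real d + x) / real b"
  have "finite D" using D by (rule finite_subset) simp
  have *: "closed (?f d ` closure ?R)" for d
    using bounded_radix_set b
    by (intro compact_imp_closed compact_continuous_image continuous_intros) auto
  have "closure ?R = closure (\<Union>d\<in>D. ?f d ` ?R)" using radix_set_eq by simp
  also have "\<dots> \<subseteq> (\<Union>d\<in>D. ?f d ` closure ?R)"
    using * \<open>finite D\<close> closure_subset by (intro closure_minimal) (auto, blast)
  finally have "closure ?R \<subseteq> ?R"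
    using bounded_radix_set by (intro radix_set_coinduct[OF b] bounded_closure) blast+
  then show ?thesis
    using bounded_radix_set closure_subset_eq compact_eq_bounded_closed by blast
qed

lemma zero_in_radix_set: "0 \<in> D \<Longrightarrow> 0 \<in> radix_set b D"
  using radix_set_coinduct[OF b, of "{0}" D] by auto

end

section \<open>The tile and its overlap with its neighbours\<close>

text \<open>The digit set of the theorem, with \<open>2 * m + 2\<close> replaced by an arbitrary base \<open>b\<close>. It is a complete
  residue system modulo \<open>b\<close>, because \<open>b + 1\<close> takes the place of the digit \<open>1\<close>. The parity of \<open>b\<close> plays
  no role.\<close>

definition tile_digits :: "nat \<Rightarrow> nat set" where
  "tile_digits b = {0} \<union> {2..b - 1} \<union> {b + 1}"

text \<open>The set under study: its integer translates cover the line and overlap only along boundaries.\<close>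

definition tile :: "nat \<Rightarrow> real set" where
  "tile b = radix_set b (tile_digits b)"

text \<open>The overlap of the tile with its left neighbour \<open>tile b - 1\<close>; it forms one half of the boundary
  of the tile.\<close>

definition seam :: "nat \<Rightarrow> real set" where
  "seam b = radix_set b {0, 1, 2}"

context
  fixes b :: nat
  assumes b: "b \<ge> 4"
begin

lemma two_le_base: "b \<ge> 2" using b by simp

lemma tile_digits_le: "tile_digits b \<subseteq> {..b + 1}"
  using b by (auto simp: tile_digits_def)

lemma seam_digits_le: "{0, 1, 2} \<subseteq> {..2 :: nat}"
  by auto

lemmas tile_consD = radix_set_consD[OF two_le_base tile_digits_le, folded tile_def]
  and tile_consI = radix_set_consI[OF two_le_base tile_digits_le, folded tile_def]
  and compact_tile = compact_radix_set[OF two_le_base tile_digits_le, folded tile_def]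
  and seam_consD = radix_set_consD[OF two_le_base seam_digits_le, folded seam_def]
  and seam_consI = radix_set_consI[OF two_le_base seam_digits_le, folded seam_def]
  and compact_seam = compact_radix_set[OF two_le_base seam_digits_le, folded seam_def]
  and seam_eq = radix_set_eq[OF two_le_base seam_digits_le, folded seam_def]
  and zero_in_seam = zero_in_radix_set[OF two_le_base seam_digits_le, folded seam_def]
  and zero_in_tile = zero_in_radix_set[OF two_le_base tile_digits_le, folded tile_def]

lemma tile_bounds:
  assumes "x \<in> tile b"
  shows "0 \<le> x" and "x \<le> 5 / 3"
proof -
  show "0 \<le> x"
    using radix_set_bounds(1)[OF two_le_base tile_digits_le] assms unfolding tile_def by blast
  have "x \<le> real (b + 1) / (real b - 1)"
    using radix_set_bounds(2)[OF two_le_base tile_digits_le] assms unfolding tile_def by blast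
  also have "\<dots> \<le> 5 / 3" using b by (simp add: field_simps)
  finally show "x \<le> 5 / 3" .
qed

lemma seam_bounds:
  assumes "x \<in> seam b"
  shows "0 \<le> x" and "x \<le> 2 / 3"
proof -
  show "0 \<le> x"
    using radix_set_bounds(1)[OF two_le_base seam_digits_le] assms unfolding seam_def by blast
  have "x \<le> real 2 / (real b - 1)"
    using radix_set_bounds(2)[OF two_le_base seam_digits_le] assms unfolding seam_def by blast
  also have "\<dots> \<le> 2 / 3" using b by (simp add: field_simps)
  finally show "x \<le> 2 / 3" .
qed

text \<open>A transducer with two states: at a point \<open>z\<close> or \<open>1 + z\<close> with \<open>z\<close> in the seam, the leading digit of
  \<open>z\<close> determines a tile digit to emit, and the digit \<open>1\<close> switches the state.\<close>

lemma seam_subset_tile: "seam b \<union> (+) 1 ` seam b \<subseteq> tile b"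
  unfolding tile_def
proof (rule radix_set_coinduct[OF two_le_base])
  let ?Y = "seam b \<union> (+) 1 ` seam b"
  show "bounded ?Y"
    using compact_seam by (simp add: compact_imp_bounded bounded_translation)
  fix y assume "y \<in> ?Y"
  then consider (l) "y \<in> seam b" | (r) x where "x \<in> seam b" "y = 1 + x" by blast
  then show "\<exists>d\<in>tile_digits b. \<exists>z\<in>?Y. y = (real d + z) / real b"
  proof cases
    case l
    then obtain d z where dz: "d \<in> {0, 1, 2}" "z \<in> seam b" "y = (real d + z) / real b"
      using seam_consD by blast
    then consider "d = 0" | "d = 1" | "d = 2" by auto
    then show ?thesis
    proof cases
      case 1
      then show ?thesis using dz by (intro bexI[of _ 0] bexI[of _ z]) (auto simp: tile_digits_def)
    next
      case 2
      then show ?thesis using dz by (intro bexI[of _ 0] bexI[of _ "1 + z"]) (auto simp: tile_digits_def)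
    next
      case 3
      then show ?thesis using dz b by (intro bexI[of _ 2] bexI[of _ z]) (auto simp: tile_digits_def)
    qed
  next
    case r
    then obtain d z where dz: "d \<in> {0, 1, 2}" "z \<in> seam b" "x = (real d + z) / real b"
      using seam_consD by blast
    then consider "d = 0" | "d = 1" | "d = 2" by auto
    then show ?thesis
    proof cases
      case 1
      then show ?thesis using dz b r
        by (intro bexI[of _ "b - 1"] bexI[of _ "1 + z"]) (auto simp: tile_digits_def field_simps of_nat_diff)
    next
      case 2
      then show ?thesis using dz b r
        by (intro bexI[of _ "b + 1"] bexI[of _ z]) (auto simp: tile_digits_def field_simps)
    next
      case 3
      then show ?thesis using dz b r
        by (intro bexI[of _ "b + 1"] bexI[of _ "1 + z"]) (auto simp: tile_digits_def field_simps)
    qed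
  qed
qed

text \<open>If \<open>x\<close> and \<open>1 + x\<close> both lie in the tile, their leading digits \<open>d\<close>, \<open>d'\<close> satisfy \<open>d' - d = b - k\<close>, where \<open>k\<close>
  is the difference of the tails, hence \<open>k \<in> {-1, 0, 1}\<close>. As the digits form a complete residue
  system, \<open>k = 0\<close> is impossible, and the other cases leave the digit pairs \<open>(2, b + 1)\<close>, \<open>(0, b - 1)\<close>
  and \<open>(0, b + 1)\<close>. They amount to emitting the seam digits \<open>2\<close>, \<open>0\<close> and \<open>1\<close>.\<close>

lemma tile_overlap_subset_seam: "{x \<in> tile b. 1 + x \<in> tile b} \<subseteq> seam b"
  unfolding seam_def
proof (rule radix_set_coinduct[OF two_le_base])
  let ?Y = "{x \<in> tile b. 1 + x \<in> tile b}"
  show "bounded ?Y"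
    using compact_imp_bounded[OF compact_tile] by (rule bounded_subset) auto
  fix x assume "x \<in> ?Y"
  then obtain d y d' y' where d: "d \<in> tile_digits b" "y \<in> tile b" "x = (real d + y) / real b"
    and d': "d' \<in> tile_digits b" "y' \<in> tile b" "1 + x = (real d' + y') / real b"
    using tile_consD by blast
  have eq: "real d' + y' = real b + real d + y"
    using d(3) d'(3) b by (simp add: field_simps)
  define k where "k = int b + int d - int d'"
  have k: "y' - y = of_int k" using eq by (simp add: k_def)
  have "\<bar>y' - y\<bar> < 2" using tile_bounds[OF d(2)] tile_bounds[OF d'(2)] by auto
  then have "\<bar>k\<bar> < 2" unfolding k by linarith
  then consider "k = 0" | "k = 1" | "k = -1" by linarith
  then show "\<exists>d\<in>{0, 1, 2}. \<exists>z\<in>?Y. x = (real d + z) / real b"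
  proof cases
    case 1
    then have "d' = b + d" by (simp add: k_def)
    then show ?thesis using d(1) d'(1) b by (auto simp: tile_digits_def)
  next
    case 2
    then have "d' + 1 = b + d" and y: "y' = 1 + y" using k by (auto simp: k_def)
    then have "d \<in> {0, 1, 2}" using d(1) d'(1) b by (auto simp: tile_digits_def)
    then show ?thesis using d d' y by blast
  next
    case 3
    then have "d' = b + d + 1" and y: "y = 1 + y'" using k by (auto simp: k_def)
    then have "d = 0" using d(1) d'(1) b by (auto simp: tile_digits_def)
    then have "x = (real 1 + y') / real b" using d(3) y by simp
    then show ?thesis using d d' y by blast
  qed
qed

lemma tile_overlap: "{x \<in> tile b. 1 + x \<in> tile b} = seam b"
  using tile_overlap_subset_seam seam_subset_tile by auto

lemma seam_iff: "x \<in> seam b \<longleftrightarrow> x \<in> tile b \<and> 1 + x \<in> tile b"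
  using tile_overlap by blast

text \<open>The only residue that is not itself a digit is \<open>1\<close>, which is represented by \<open>b + 1\<close>.\<close>

lemma tile_digit_residue: "\<exists>d\<in>tile_digits b. \<exists>q. N = int b * q + int d"
proof -
  define r where "r = nat (N mod int b)"
  have r: "int r = N mod int b" "r < b" using b by (auto simp: r_def nat_less_iff)
  have N: "N = int b * (N div int b) + int r" using r(1) by simp
  show ?thesis
  proof (cases "r = 1")
    case True
    then have "N = int b * (N div int b - 1) + int (b + 1)" using N by (simp add: algebra_simps)
    then show ?thesis by (intro bexI[of _ "b + 1"] exI) (auto simp: tile_digits_def)
  next
    case False
    then have "r \<in> tile_digits b" using r b by (auto simp: tile_digits_def)
    then show ?thesis using N by blast
  qed
qed

text \<open>The union \<open>T\<close> of all integer translates is closed, and \<open>x \<in> T\<close> implies \<open>x / b \<in> T\<close> by the residue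
  property. Since every real is within distance \<open>1\<close> of \<open>T\<close>, rescaling shows that \<open>T\<close> is dense.\<close>

lemma tile_translates_cover: "\<exists>k. x - real_of_int k \<in> tile b"
proof -
  define T where "T = (\<Union>x\<in>tile b. \<Union>y\<in>\<int>. {x + y})"
  have T: "x \<in> T \<longleftrightarrow> (\<exists>k. x - real_of_int k \<in> tile b)" for x
  proof
    assume "\<exists>k. x - real_of_int k \<in> tile b"
    then obtain k where "x - real_of_int k \<in> tile b" by blast
    moreover have "x = (x - real_of_int k) + real_of_int k" by simp
    ultimately show "x \<in> T" unfolding T_def using Ints_of_int by blast
  next
    assume "x \<in> T"
    then obtain y k where "x = y + real_of_int k" "y \<in> tile b"
      unfolding T_def by (auto simp: Ints_def)
    then show "\<exists>k. x - real_of_int k \<in> tile b" by (intro exI[of _ k]) simp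
  qed
  have div: "x / real b \<in> T" if "x \<in> T" for x
  proof -
    obtain k where k: "x - real_of_int k \<in> tile b" using \<open>x \<in> T\<close> T by blast
    obtain d q where d: "d \<in> tile_digits b" "k = int b * q + int d"
      using tile_digit_residue by blast
    have "(real d + (x - of_int k)) / real b \<in> tile b" using tile_consI k d by blast
    moreover have "(real d + (x - of_int k)) / real b = x / real b - of_int q"
      using b d(2) by (simp add: field_simps)
    ultimately show ?thesis using T by auto
  qed
  have approx: "\<exists>y\<in>T. \<bar>x - y\<bar> \<le> (1 / real b) ^ n" for x n
  proof (induction n arbitrary: x)
    case 0
    have "real_of_int \<lfloor>x\<rfloor> \<in> T"
      using zero_in_tile T by (auto simp: tile_digits_def intro!: exI[of _ "\<lfloor>x\<rfloor>"])
    moreover have "\<bar>x - real_of_int \<lfloor>x\<rfloor>\<bar> \<le> 1" by linarith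
    ultimately show ?case unfolding power_0 by blast
  next
    case (Suc n)
    obtain y where y: "y \<in> T" "\<bar>real b * x - y\<bar> \<le> (1 / real b) ^ n" using Suc by blast
    have "\<bar>x - y / real b\<bar> = \<bar>real b * x - y\<bar> / real b"
      using b by (simp add: abs_if field_simps)
    also have "\<dots> \<le> (1 / real b) ^ Suc n" using y(2) b by (simp add: divide_right_mono)
    finally show ?case using div[OF y(1)] by blast
  qed
  have "closed T" unfolding T_def
    by (intro compact_closed_sums compact_tile closed_Ints)
  moreover have "x \<in> closure T"
    unfolding closure_approachable
  proof (intro allI impI)
    fix e :: real assume "e > 0"
    obtain n where "(1 / real b) ^ n < e"
      using real_arch_pow_inv[OF \<open>e > 0\<close>, of "1 / real b"] b by auto
    then show "\<exists>y\<in>T. dist y x < e"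
      using approx[of x n] by (force simp: dist_real_def abs_minus_commute)
  qed
  ultimately show ?thesis using T closure_closed by blast
qed

end

section \<open>Boundary and measure of the tile\<close>

context
  fixes b :: nat
  assumes b: "b \<ge> 4"
begin

text \<open>Self-similarity with three pieces of ratio \<open>1 / b\<close> gives \<open>\<mu> \<le> (3 / b) * \<mu>\<close> for the measure \<open>\<mu>\<close> of
  the seam, where \<open>3 / b < 1\<close>.\<close>

lemma seam_null: "seam b \<in> null_sets lebesgue"
proof -
  let ?S = "seam b" and ?f = "\<lambda>d x. (real d + x) / real b"
  have S: "?S \<in> lmeasurable"
    using compact_seam[OF b] by (rule lmeasurable_compact)
  have comp: "compact (?f d ` ?S)" for d
    using b by (intro compact_continuous_image continuous_intros compact_seam) auto
  then have mf: "?f d ` ?S \<in> lmeasurable" for d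
    by (rule lmeasurable_compact)
  have scale: "measure lebesgue (?f d ` ?S) = measure lebesgue ?S / real b" for d
  proof -
    have "?f d ` ?S = (\<lambda>x. (1 / real b) *\<^sub>R x + real d / real b) ` ?S"
      by (simp add: add_divide_distrib add.commute)
    then show ?thesis by (simp only: measure_lebesgue_affine) simp
  qed
  have "?S = (\<Union>d\<in>{0, 1, 2}. ?f d ` ?S)"
    by (rule seam_eq[OF b])
  then have "measure lebesgue ?S \<le> (\<Sum>d\<in>{0, 1, 2::nat}. measure lebesgue (?f d ` ?S))"
    using measure_UNION_le[of "{0, 1, 2::nat}" "\<lambda>d. ?f d ` ?S" lebesgue] mf
    by (metis (no_types, lifting) finite.intros fmeasurableD)
  also have "\<dots> = 3 / real b * measure lebesgue ?S"
    unfolding scale by simp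
  finally have "measure lebesgue ?S * (1 - 3 / real b) \<le> 0" by (simp add: algebra_simps)
  moreover have "1 - 3 / real b > 0" using b by simp
  ultimately have "measure lebesgue ?S \<le> 0" by (simp add: mult_le_0_iff)
  then have "measure lebesgue ?S = 0" using measure_nonneg[of lebesgue ?S] by linarith
  then show ?thesis using S by (simp add: null_sets_def emeasure_eq_measure2 fmeasurableD)
qed

lemma null_sets_lebesgue_translation:
  "S \<in> null_sets lebesgue \<Longrightarrow> (+) (a::real) ` S \<in> null_sets lebesgue"
  using negligible_translation by (simp add: negligible_iff_null_sets)

lemma seam_translate_null: "(+) 1 ` seam b \<in> null_sets lebesgue"
  using seam_null by (rule null_sets_lebesgue_translation)

text \<open>A point of the tile off both seams has a neighbourhood that meets no other integer translate;
  as the translates cover the line, that neighbourhood lies in the tile.\<close>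

lemma frontier_tile_subset: "frontier (tile b) \<subseteq> seam b \<union> (+) 1 ` seam b"
proof
  let ?X = "tile b"
  fix x assume x: "x \<in> frontier ?X"
  have "closed ?X" using compact_tile[OF b] by (rule compact_imp_closed)
  then have xX: "x \<in> ?X" and ni: "x \<notin> interior ?X"
    using x by (auto simp: frontier_def)
  show "x \<in> seam b \<union> (+) 1 ` seam b"
  proof (rule ccontr)
    assume nx: "x \<notin> seam b \<union> (+) 1 ` seam b"
    \<comment> \<open>Translates by \<open>k\<close> with \<open>\<bar>k\<bar> \<ge> 2\<close> miss the interval, as the tile lies in \<open>[0, 5 / 3]\<close>.\<close>
    define V where "V = {-1/3<..<2} - (+) (-1) ` ?X - (+) 1 ` ?X"
    have "open V" unfolding V_def
      using \<open>closed ?X\<close> by (intro open_Diff closed_translation) auto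
    have "V \<subseteq> ?X"
    proof
      fix y assume y: "y \<in> V"
      obtain k where k: "y - real_of_int k \<in> ?X"
        using tile_translates_cover[OF b] by blast
      have "-1/3 < y" "y < 2" using y by (auto simp: V_def)
      then have "-2 < real_of_int k" "real_of_int k < 2"
        using tile_bounds[OF b k] by auto
      then have "k = -1 \<or> k = 0 \<or> k = 1" by linarith
      moreover have "k \<noteq> -1" "k \<noteq> 1"
        using y k by (auto simp: V_def image_iff)
      ultimately show "y \<in> ?X" using k by auto
    qed
    moreover have "x \<in> V"
    proof -
      have "x \<notin> (+) (-1) ` ?X"
        using xX nx tile_overlap[OF b] by auto
      moreover have "x \<notin> (+) 1 ` ?X"
        using xX nx tile_overlap[OF b] by auto
      ultimately show ?thesis using tile_bounds[OF b xX] by (auto simp: V_def)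
    qed
    ultimately show False using ni \<open>open V\<close> interior_maximal by blast
  qed
qed

text \<open>Otherwise the tile would be a null set, and so would be the line, as a countable union of its
  translates.\<close>

lemma interior_tile_nonempty: "interior (tile b) \<noteq> {}"
proof
  assume e: "interior (tile b) = {}"
  have "tile b \<subseteq> frontier (tile b)" using e closure_subset by (auto simp: frontier_def)
  then have "tile b \<subseteq> seam b \<union> (+) 1 ` seam b" using frontier_tile_subset by blast
  then have "tile b \<in> null_sets lebesgue"
    using seam_null seam_translate_null by (meson null_sets.Un null_sets_completion_subset)
  then have "(+) (real_of_int k) ` tile b \<in> null_sets lebesgue" for k
    by (rule null_sets_lebesgue_translation)
  then have "(\<Union>k. (+) (real_of_int k) ` tile b) \<in> null_sets lebesgue"
    by (intro null_sets_UN)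
  moreover have "(\<Union>k. (+) (real_of_int k) ` tile b) = UNIV"
  proof -
    have "x \<in> (\<Union>k. (+) (real_of_int k) ` tile b)" for x
      using tile_translates_cover[OF b, of x] by (auto simp: image_iff) (metis diff_add_cancel add.commute)
    then show ?thesis by blast
  qed
  ultimately show False by (auto simp: null_sets_def)
qed

text \<open>The contractions that prepend a digit map interior points of the tile to interior points, so
  prepending the first \<open>n\<close> digits of \<open>x\<close> to a fixed interior point approximates \<open>x\<close> within \<open>2 * b ^ (-n)\<close>.\<close>

lemma tile_subset_closure_interior: "tile b \<subseteq> closure (interior (tile b))"
proof
  let ?I = "interior (tile b)"
  obtain y0 where y0: "y0 \<in> ?I" using interior_tile_nonempty by blast
  have approx: "\<exists>y\<in>?I. \<bar>x - y\<bar> \<le> 2 * (1 / real b) ^ n" if "x \<in> tile b" for x n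
    using that
  proof (induction n arbitrary: x)
    case 0
    have "y0 \<in> tile b" using y0 interior_subset by blast
    then have "\<bar>x - y0\<bar> \<le> 2" using tile_bounds[OF b] 0 by (force simp: abs_if)
    then show ?case using y0 by auto
  next
    case (Suc n)
    obtain d z where d: "d \<in> tile_digits b" "z \<in> tile b" "x = (real d + z) / real b"
      using tile_consD[OF b Suc.prems] by blast
    obtain y where y: "y \<in> ?I" "\<bar>z - y\<bar> \<le> 2 * (1 / real b) ^ n" using Suc.IH[OF d(2)] by blast
    let ?f = "\<lambda>x. (real d + x) / real b"
    have "?f ` ?I = (+) (real d / real b) ` ((*\<^sub>R) (1 / real b) ` ?I)"
      by (auto simp: image_image add_divide_distrib)
    moreover have "open ((+) (real d / real b) ` ((*\<^sub>R) (1 / real b) ` ?I))"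
      using b by (intro open_translation open_scaling) auto
    ultimately have "open (?f ` ?I)" by simp
    moreover have "?f ` ?I \<subseteq> tile b" using tile_consI[OF b d(1)] interior_subset by blast
    ultimately have "?f y \<in> ?I" using y(1) interior_maximal by blast
    moreover have "\<bar>x - ?f y\<bar> = \<bar>z - y\<bar> / real b"
      using b unfolding d(3) by (simp add: abs_if field_simps)
    then have "\<bar>x - ?f y\<bar> \<le> 2 * (1 / real b) ^ Suc n" using y(2) b by (simp add: divide_right_mono)
    ultimately show ?case by blast
  qed
  fix x assume x: "x \<in> tile b"
  show "x \<in> closure ?I"
    unfolding closure_approachable
  proof (intro allI impI)
    fix e :: real assume "e > 0"
    then obtain n where "(1 / real b) ^ n < e / 2"
      using real_arch_pow_inv[of "e / 2" "1 / real b"] b by auto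
    then show "\<exists>y\<in>?I. dist y x < e"
      using approx[OF x, of n] by (force simp: dist_real_def abs_minus_commute)
  qed
qed

lemma interior_seam_empty: "interior (seam b) = {}" "interior ((+) 1 ` seam b) = {}"
proof -
  have *: "interior S = {}" if "S \<in> null_sets lebesgue" for S :: "real set"
  proof (rule ccontr)
    assume "interior S \<noteq> {}"
    moreover have "interior S \<in> null_sets lebesgue"
      using that interior_subset null_sets_completion_subset by blast
    ultimately show False using open_not_negligible[of "interior S"]
      by (simp add: negligible_iff_null_sets)
  qed
  show "interior (seam b) = {}" "interior ((+) 1 ` seam b) = {}"
    using * seam_null seam_translate_null by blast+
qed

text \<open>A seam point in the interior of the tile would be a limit of interior points of the neighbouring
  tile, so the two tiles would overlap in a nonempty open subset of a null seam.\<close>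

lemma frontier_tile: "frontier (tile b) = seam b \<union> (+) 1 ` seam b"
proof (rule equalityI[OF frontier_tile_subset])
  let ?I = "interior (tile b)"
  have cl: "closure (tile b) = tile b" using compact_tile[OF b] by (simp add: compact_imp_closed)
  have *: "x \<in> frontier (tile b)" if x: "x \<in> tile b" "x - c \<in> tile b"
    and e: "interior (tile b \<inter> (+) c ` tile b) = {}" for x c
  proof (rule ccontr)
    assume "x \<notin> frontier (tile b)"
    then have "x \<in> ?I" using x cl by (simp add: frontier_def)
    moreover have "x \<in> closure ((+) c ` ?I)"
    proof -
      have "x - c \<in> closure ?I" using x(2) tile_subset_closure_interior by blast
      then show ?thesis unfolding closure_translation by (auto simp: image_iff intro!: bexI[of _ "x - c"])
    qed
    ultimately have ne: "?I \<inter> (+) c ` ?I \<noteq> {}"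
      using open_Int_closure_eq_empty[OF open_interior] by blast
    have "open (?I \<inter> (+) c ` ?I)" by (simp add: open_Int open_translation)
    then have "?I \<inter> (+) c ` ?I \<subseteq> interior (tile b \<inter> (+) c ` tile b)"
      using interior_subset by (intro interior_maximal) blast+
    then show False using ne e by blast
  qed
  show "seam b \<union> (+) 1 ` seam b \<subseteq> frontier (tile b)"
  proof
    fix x assume "x \<in> seam b \<union> (+) 1 ` seam b"
    then show "x \<in> frontier (tile b)"
    proof
      assume "x \<in> seam b"
      moreover have "tile b \<inter> (+) (-1) ` tile b = seam b"
        using tile_overlap[OF b] by (force simp: image_iff)
      moreover have "x \<in> tile b" "x - (-1) \<in> tile b"
        using \<open>x \<in> seam b\<close> seam_iff[OF b, of x] by (simp_all add: add.commute)
      ultimately show ?thesis using *[of x "-1"] interior_seam_empty(1) by simp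
    next
      assume "x \<in> (+) 1 ` seam b"
      then obtain y where y: "y \<in> seam b" "x = 1 + y" by blast
      moreover have "tile b \<inter> (+) 1 ` tile b = (+) 1 ` seam b"
        using tile_overlap[OF b] by (force simp: image_iff)
      moreover have "x \<in> tile b" "x - 1 \<in> tile b"
        using y seam_iff[OF b] by simp_all
      ultimately show ?thesis using *[of x 1] interior_seam_empty(2) by simp
    qed
  qed
qed

lemma frontier_tile_null: "frontier (tile b) \<in> null_sets lebesgue"
  unfolding frontier_tile using seam_null seam_translate_null by (rule null_sets.Un)

text \<open>Moving the part of the tile in \<open>[1, 2)\<close> to the left by \<open>1\<close> fills \<open>[0, 1)\<close>, with overlap contained in
  the null seam.\<close>

lemma measure_tile: "emeasure lebesgue (tile b) = 1"
proof -
  let ?X = "tile b"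
  have X: "?X \<in> sets lebesgue"
    using compact_tile[OF b] by (intro fmeasurableD lmeasurable_compact)
  define A B where "A = ?X \<inter> {0..<1}" and "B = ?X \<inter> {1..<2}"
  define B' where "B' = (+) (-1) ` B"
  have sets: "A \<in> sets lebesgue" "B \<in> sets lebesgue" using X by (auto simp: A_def B_def)
  have B': "B' \<in> sets lebesgue" "emeasure lebesgue B' = emeasure lebesgue B"
    unfolding B'_def using sets lebesgue_sets_translation[of B "-1"] emeasure_lebesgue_affine[of 1 "-1" B]
    by (simp_all add: add.commute)
  have "?X = A \<union> B" using tile_bounds[OF b] by (force simp: A_def B_def)
  moreover have "A \<inter> B = {}" by (auto simp: A_def B_def)
  ultimately have "emeasure lebesgue ?X = emeasure lebesgue A + emeasure lebesgue B"
    using sets plus_emeasure by metis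
  also have "\<dots> = emeasure lebesgue A + emeasure lebesgue B'" using B' by simp
  also have "\<dots> = emeasure lebesgue (A \<union> B')"
  proof -
    have "x \<in> seam b" if "x \<in> A \<inter> B'" for x
    proof -
      have "x \<in> ?X" "1 + x \<in> ?X" using that by (auto simp: A_def B'_def B_def)
      then show ?thesis using seam_iff[OF b] by blast
    qed
    then have "A \<inter> B' \<subseteq> seam b" by blast
    then have "A \<inter> B' \<in> null_sets lebesgue" using seam_null null_sets_completion_subset by blast
    then show ?thesis using emeasure_Un'[of A lebesgue B'] sets B' by simp
  qed
  also have "A \<union> B' = {0..<1}"
  proof
    show "A \<union> B' \<subseteq> {0..<1}" by (auto simp: A_def B'_def B_def)
    show "{0..<1} \<subseteq> A \<union> B'"
    proof
      fix x :: real assume x: "x \<in> {0..<1}"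
      obtain k where k: "x - real_of_int k \<in> ?X" using tile_translates_cover[OF b] by blast
      have "-2 < real_of_int k" "real_of_int k < 1"
        using tile_bounds[OF b k] x by auto
      then have "k = -1 \<or> k = 0" by linarith
      then show "x \<in> A \<union> B'"
      proof
        assume "k = -1"
        then have "x + 1 \<in> B" using k x by (simp add: B_def)
        then show ?thesis unfolding B'_def by (auto simp: image_iff intro!: bexI[of _ "x + 1"])
      qed (use k x in \<open>simp add: A_def\<close>)
    qed
  qed
  finally show ?thesis by simp
qed

lemma measure_interior_tile: "emeasure lebesgue (interior (tile b)) = 1"
proof -
  have "closed (tile b)" using compact_tile[OF b] by (rule compact_imp_closed)
  then have "interior (tile b) = tile b - frontier (tile b)"
    using interior_subset by (auto simp: frontier_def)
  moreover have "tile b \<in> sets lebesgue"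
    using compact_tile[OF b] by (intro fmeasurableD lmeasurable_compact)
  ultimately show ?thesis
    using emeasure_Diff_null_set[OF frontier_tile_null] measure_tile by simp
qed

end

section \<open>Hausdorff dimension of the boundary\<close>

lemma hausdorff_premeasure_le_intervals:
  fixes A E :: "real set"
  assumes E: "finite E" and cov: "A \<subseteq> (\<Union>x\<in>E. {x..x + \<epsilon>})" and \<epsilon>: "0 < \<epsilon>" "\<epsilon> \<le> \<delta>" and s: "s > 0"
  shows "hausdorff_premeasure s \<delta> A \<le> ennreal (real (card E) * \<epsilon> powr s)"
proof -
  obtain h where h: "bij_betw h {0..<card E} E" using ex_bij_betw_nat_finite[OF E] by blast
  define U where "U i = (if i < card E then {h i..h i + \<epsilon>} else {})" for i
  have "A \<subseteq> (\<Union>i. U i)"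
  proof
    fix x assume "x \<in> A"
    then obtain e where "e \<in> E" "x \<in> {e..e + \<epsilon>}" using cov by blast
    moreover obtain i where "i < card E" "h i = e"
      using bij_betw_imp_surj_on[OF h] \<open>e \<in> E\<close> by (metis atLeastLessThan_iff imageE)
    ultimately show "x \<in> (\<Union>i. U i)" by (auto simp: U_def intro!: exI[of _ i])
  qed
  moreover have "bounded (U i) \<and> diameter (U i) \<le> \<delta>" for i
    using \<epsilon> by (simp add: U_def diameter_closed_interval)
  ultimately have "hausdorff_premeasure s \<delta> A \<le> (\<Sum>i. diam_gauge s (U i))"
    unfolding hausdorff_premeasure_def by (intro INF_lower) blast
  also have "\<dots> = (\<Sum>i<card E. diam_gauge s (U i))"
    by (intro suminf_finite) (auto simp: U_def diam_gauge_def)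
  also have "\<dots> = (\<Sum>i<card E. ennreal (\<epsilon> powr s))"
    using \<epsilon> s by (intro sum.cong) (auto simp: U_def diam_gauge_def diameter_closed_interval)
  also have "\<dots> = ennreal (real (card E) * \<epsilon> powr s)"
    by (simp add: ennreal_mult'' ennreal_of_nat_eq_real_of_nat)
  finally show ?thesis .
qed

lemma hausdorff_dim_eqI:
  assumes "d \<ge> 0"
    and upper: "\<And>s. s > d \<Longrightarrow> hausdorff_measure s A = 0"
    and lower: "\<And>s. 0 \<le> s \<Longrightarrow> s \<le> d \<Longrightarrow> hausdorff_measure s A \<noteq> 0"
  shows "hausdorff_dim A = ennreal d"
proof (rule antisym)
  show "hausdorff_dim A \<le> ennreal d"
  proof (rule ennreal_le_epsilon)
    fix e :: real assume "e > 0"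
    then have "hausdorff_dim A \<le> ennreal (d + e)"
      unfolding hausdorff_dim_def using assms(1) upper[of "d + e"]
      by (intro Inf_lower CollectI exI[of _ "d + e"]) auto
    then show "hausdorff_dim A \<le> ennreal d + ennreal e" using assms(1) \<open>e > 0\<close> by simp
  qed
  show "ennreal d \<le> hausdorff_dim A"
    unfolding hausdorff_dim_def
  proof (rule Inf_greatest)
    fix t assume "t \<in> {ennreal s |s. 0 \<le> s \<and> hausdorff_measure s A = 0}"
    then obtain s where "t = ennreal s" "0 \<le> s" "hausdorff_measure s A = 0" by blast
    then show "ennreal d \<le> t" using lower[of s] by (cases "s \<le> d") (auto intro: ennreal_leI)
  qed
qed

context
  fixes b :: nat
  assumes b: "b \<ge> 4"
begin

text \<open>The \<open>n\<close>-th generation cylinders of the seam: \<open>3 ^ n\<close> intervals of length \<open>b ^ (-n)\<close>.\<close>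

lemma seam_interval_cover:
  "\<exists>E. finite E \<and> card E \<le> 3 ^ n \<and> seam b \<subseteq> (\<Union>x\<in>E. {x..x + (1 / real b) ^ n})"
proof (induction n)
  case 0
  show ?case using seam_bounds[OF b] by (intro exI[of _ "{0}"]) force
next
  case (Suc n)
  then obtain E where E: "finite E" "card E \<le> 3 ^ n" "seam b \<subseteq> (\<Union>x\<in>E. {x..x + (1 / real b) ^ n})"
    by blast
  let ?f = "\<lambda>d x. (real d + x) / real b"
  let ?E = "\<Union>d\<in>{0, 1, 2}. ?f d ` E"
  have "card ?E \<le> (\<Sum>d\<in>{0, 1, 2::nat}. card (?f d ` E))" by (rule card_UN_le) simp
  also have "\<dots> \<le> (\<Sum>d\<in>{0, 1, 2::nat}. 3 ^ n)"
    using E by (intro sum_mono) (meson card_image_le le_trans)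
  finally have "card ?E \<le> 3 ^ Suc n" by simp
  moreover have "seam b \<subseteq> (\<Union>x\<in>?E. {x..x + (1 / real b) ^ Suc n})"
  proof
    fix x assume "x \<in> seam b"
    then obtain d y where d: "d \<in> {0, 1, 2}" "y \<in> seam b" "x = ?f d y" using seam_consD[OF b] by blast
    then obtain e where e: "e \<in> E" "e \<le> y" "y \<le> e + (1 / real b) ^ n" using E(3) by fastforce
    have "?f d e \<le> x" "x \<le> ?f d e + (1 / real b) ^ Suc n"
      using e b unfolding d(3) by (simp_all add: divide_right_mono add_divide_distrib[symmetric])
    then show "x \<in> (\<Union>x\<in>?E. {x..x + (1 / real b) ^ Suc n})"
      using d(1) e(1) by (intro UN_I[of "?f d e"]) auto
  qed
  moreover have "finite ?E" using E(1) by simp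
  ultimately show ?case by blast
qed

lemma log_base_3: "0 < log (real b) 3" "log (real b) 3 < 1"
  using b by (simp_all add: log_less_one_cancel_iff)

lemma powr_log_base_3: "real b powr log (real b) 3 = 3"
  using b by simp

lemma seams_measure_zero:
  assumes s: "s > log (real b) 3"
  shows "hausdorff_measure s (seam b \<union> (+) 1 ` seam b) = 0"
proof -
  let ?S = "seam b \<union> (+) 1 ` seam b"
  have s0: "s > 0" using s log_base_3 by linarith
  have "real b powr log (real b) 3 < real b powr s" using b s by (intro powr_less_mono) auto
  then have bs: "3 < real b powr s" unfolding powr_log_base_3 .
  have bound: "hausdorff_premeasure s \<delta> ?S \<le> ennreal (2 * (3 / real b powr s) ^ n)"
    if n: "(1 / real b) ^ n \<le> \<delta>" for \<delta> n
  proof -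
    let ?\<epsilon> = "(1 / real b) ^ n"
    obtain E where E: "finite E" "card E \<le> 3 ^ n" "seam b \<subseteq> (\<Union>x\<in>E. {x..x + ?\<epsilon>})"
      using seam_interval_cover by blast
    let ?E = "E \<union> (+) 1 ` E"
    have "card ?E \<le> card E + card ((+) 1 ` E)" by (rule card_Un_le)
    also have "\<dots> \<le> 2 * 3 ^ n" using E card_image_le[OF E(1), of "(+) 1"] by linarith
    finally have "real (card ?E) \<le> real (2 * 3 ^ n)" by (simp only: of_nat_le_iff)
    then have card: "real (card ?E) \<le> 2 * 3 ^ n" by simp
    have "?S \<subseteq> (\<Union>x\<in>?E. {x..x + ?\<epsilon>})" using E(3) by fastforce
    then have "hausdorff_premeasure s \<delta> ?S \<le> ennreal (real (card ?E) * ?\<epsilon> powr s)"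
      using E(1) n s0 b by (intro hausdorff_premeasure_le_intervals) auto
    also have "\<dots> \<le> ennreal (2 * 3 ^ n * ?\<epsilon> powr s)"
      using card by (intro ennreal_leI mult_right_mono) auto
    also have "?\<epsilon> powr s = (1 / real b powr s) ^ n"
      using b by (simp add: powr_realpow[symmetric] powr_powr mult.commute powr_divide power_one_over powr_power)
    also have "2 * 3 ^ n * (1 / real b powr s) ^ n = 2 * (3 / real b powr s) ^ n"
      by (simp add: power_divide)
    finally show ?thesis .
  qed
  have "hausdorff_premeasure s \<delta> ?S = 0" if "\<delta> > 0" for \<delta>
  proof -
    have "(\<lambda>n. (1 / real b) ^ n) \<longlonglongrightarrow> 0" using b by (intro LIMSEQ_power_zero) auto
    then have "\<forall>\<^sub>F n in sequentially. (1 / real b) ^ n < \<delta>" using \<open>\<delta> > 0\<close> by (rule order_tendstoD)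
    then have ev: "\<forall>\<^sub>F n in sequentially. hausdorff_premeasure s \<delta> ?S \<le> ennreal (2 * (3 / real b powr s) ^ n)"
      by eventually_elim (rule bound, simp)
    have "norm (3 / real b powr s) < 1" using bs by (simp add: divide_simps)
    then have "(\<lambda>n. ennreal (2 * (3 / real b powr s) ^ n)) \<longlonglongrightarrow> ennreal (2 * 0)"
      by (intro tendsto_ennrealI tendsto_mult_left LIMSEQ_power_zero)
    then have "hausdorff_premeasure s \<delta> ?S \<le> ennreal (2 * 0)"
      using ev by (intro tendsto_lowerbound[of _ _ sequentially]) auto
    then show ?thesis by simp
  qed
  then show ?thesis unfolding hausdorff_measure_def by (simp add: SUP_eq_const)
qed

text \<open>The graph of the map from the seam onto \<open>[0, 1]\<close> that reads a digit sequence over \<open>{0, 1, 2}\<close> in base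
  \<open>3\<close> instead of base \<open>b\<close>. A relation is used so that uniqueness of the digits need not be
  established first.\<close>

definition matched :: "real \<Rightarrow> real \<Rightarrow> bool" where
  "matched x p \<longleftrightarrow> (\<exists>\<epsilon>. (\<forall>n. \<epsilon> n \<in> {0, 1, 2}) \<and> x = radix_val b \<epsilon> \<and> p = radix_val 3 \<epsilon>)"

lemma matched_cons:
  assumes "matched x p"
  shows "\<exists>d\<in>{0, 1, 2::nat}. \<exists>y q. matched y q \<and> x = (real d + y) / real b \<and> p = (real d + q) / 3"
proof -
  obtain \<epsilon> where \<epsilon>: "\<And>n. \<epsilon> n \<in> {0, 1, 2}" "x = radix_val b \<epsilon>" "p = radix_val 3 \<epsilon>"
    using assms by (auto simp: matched_def)
  let ?\<epsilon> = "\<lambda>n. \<epsilon> (Suc n)"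
  have le: "\<epsilon> n \<le> 2" for n using \<epsilon>(1)[of n] by auto
  have "x = (real (\<epsilon> 0) + radix_val b ?\<epsilon>) / real b"
    unfolding \<epsilon>(2) using b by (intro radix_val_step[OF _ le]) simp
  moreover have "p = (real (\<epsilon> 0) + radix_val 3 ?\<epsilon>) / real 3"
    unfolding \<epsilon>(3) by (intro radix_val_step[OF _ le]) simp
  moreover have "matched (radix_val b ?\<epsilon>) (radix_val 3 ?\<epsilon>)"
    unfolding matched_def using \<epsilon>(1) by (intro exI[of _ ?\<epsilon>]) simp
  ultimately show ?thesis using \<epsilon>(1)[of 0] by (metis of_nat_numeral)
qed

lemma matched_bounds:
  assumes "matched x p"
  shows "x \<in> seam b" "0 \<le> p" "p \<le> 1"
proof -
  show "x \<in> seam b" using assms by (auto simp: matched_def seam_def radix_set_iff)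
  have "p \<in> radix_set 3 {0, 1, 2}" using assms by (auto simp: matched_def radix_set_iff)
  then show "0 \<le> p" "p \<le> 1"
    using radix_set_bounds[of 3 "{0, 1, 2}" 2 p] by auto
qed

lemma matched_surj:
  assumes "0 \<le> p" "p \<le> 1"
  shows "\<exists>x. matched x p"
proof -
  have "{0..1} \<subseteq> radix_set 3 {0, 1, 2}"
  proof (rule radix_set_coinduct)
    fix y :: real assume "y \<in> {0..1}"
    then consider "y \<in> {0..1/3}" | "y \<in> {1/3..2/3}" | "y \<in> {2/3..1}" by fastforce
    then show "\<exists>d\<in>{0, 1, 2}. \<exists>z\<in>{0..1}. y = (real d + z) / real 3"
    proof cases
      case 1 then show ?thesis by (intro bexI[of _ 0] bexI[of _ "3 * y"]) auto
    next
      case 2 then show ?thesis by (intro bexI[of _ 1] bexI[of _ "3 * y - 1"]) auto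
    next
      case 3 then show ?thesis by (intro bexI[of _ 2] bexI[of _ "3 * y - 2"]) auto
    qed
  qed auto
  then show ?thesis using assms by (auto simp: matched_def radix_set_iff subset_iff)
qed

text \<open>Seam points closer than \<open>b ^ (-n) / 3\<close> share their first \<open>n\<close> digits, because distinct leading digits
  separate two points by at least \<open>(1 - 2 / 3) / b\<close>.\<close>

lemma matched_close:
  assumes "matched x p" "matched y q" and "\<bar>x - y\<bar> < (1 / real b) ^ n / 3"
  shows "\<bar>p - q\<bar> \<le> (1 / 3) ^ n"
  using assms
proof (induction n arbitrary: x p y q)
  case 0
  show ?case using matched_bounds[OF 0(1)] matched_bounds[OF 0(2)] by auto
next
  case (Suc n)
  obtain d x' p' where d: "d \<in> {0, 1, 2}" "matched x' p'" "x = (real d + x') / real b" "p = (real d + p') / 3"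
    using matched_cons[OF Suc.prems(1)] by blast
  obtain e y' q' where e: "e \<in> {0, 1, 2}" "matched y' q'" "y = (real e + y') / real b" "q = (real e + q') / 3"
    using matched_cons[OF Suc.prems(2)] by blast
  have "x - y = ((real d - real e) + (x' - y')) / real b"
    unfolding d(3) e(3) using b by (simp add: field_simps)
  then have "\<bar>x - y\<bar> * real b = \<bar>(real d - real e) + (x' - y')\<bar>"
    using b by (simp add: abs_divide)
  moreover have "\<bar>x - y\<bar> * real b < (1 / real b) ^ Suc n / 3 * real b"
    using Suc.prems(3) b by (intro mult_strict_right_mono) auto
  ultimately have *: "\<bar>(real d - real e) + (x' - y')\<bar> < (1 / real b) ^ n / 3"
    using b by simp
  also have "\<dots> \<le> 1 / 3" using b by (simp add: power_le_one)
  finally have "\<bar>(real d - real e) + (x' - y')\<bar> < 1 / 3" .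
  moreover have "\<bar>x' - y'\<bar> \<le> 2 / 3"
    using seam_bounds[OF b matched_bounds(1)[OF d(2)]] seam_bounds[OF b matched_bounds(1)[OF e(2)]] by linarith
  ultimately have "\<bar>real d - real e\<bar> < 1" by linarith
  then have "d = e" by linarith
  then have "\<bar>p' - q'\<bar> \<le> (1 / 3) ^ n" using * Suc.IH[OF d(2) e(2)] by simp
  moreover have pq: "p - q = (p' - q') / 3"
    using \<open>d = e\<close> d(4) e(4) by (simp add: diff_divide_distrib)
  ultimately show ?case unfolding pq by (simp add: abs_divide)
qed

text \<open>The map is Hoelder continuous with exponent \<open>log b 3\<close>, since \<open>3 ^ (-n)\<close> is the \<open>log b 3\<close>-th power of
  \<open>b ^ (-n)\<close>.\<close>

lemma matched_hoelder:
  assumes "matched x p" "matched y q"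
  shows "\<bar>p - q\<bar> \<le> 9 * \<bar>x - y\<bar> powr log (real b) 3"
proof (cases "x = y")
  case True
  have "\<bar>p - q\<bar> \<le> (1 / 3) ^ n" for n
    using assms True b by (intro matched_close) auto
  moreover have "(\<lambda>n. (1 / 3 :: real) ^ n) \<longlonglongrightarrow> 0" by (intro LIMSEQ_power_zero) auto
  ultimately have "\<bar>p - q\<bar> \<le> 0" by (intro LIMSEQ_le_const) auto
  then show ?thesis by simp
next
  case False
  let ?s = "log (real b) 3" and ?t = "3 * \<bar>x - y\<bar>"
  have ex: "\<exists>n. (1 / real b) ^ n \<le> ?t"
    using real_arch_pow_inv[of ?t "1 / real b"] False b by (auto intro: less_imp_le)
  \<comment> \<open>The scale of \<open>\<bar>x - y\<bar>\<close>: one factor \<open>3\<close> of the constant is lost by rounding to a power of \<open>b\<close>, the other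
    one comes from the gap \<open>1 / 3\<close>, using \<open>log b 3 \<le> 1\<close>.\<close>
  define n where "n = (LEAST n. (1 / real b) ^ n \<le> ?t)"
  have n: "(1 / real b) ^ n \<le> ?t" unfolding n_def using ex by (rule LeastI_ex)
  have pq: "\<bar>p - q\<bar> \<le> 3 * (1 / 3) ^ n"
  proof (cases n)
    case 0
    then show ?thesis using matched_bounds[OF assms(1)] matched_bounds[OF assms(2)] by auto
  next
    case (Suc k)
    then have "\<not> (1 / real b) ^ k \<le> ?t" unfolding n_def by (metis lessI not_less_Least)
    then have "\<bar>p - q\<bar> \<le> (1 / 3) ^ k" by (intro matched_close[OF assms]) simp
    then show ?thesis using Suc by simp
  qed
  have "(1 / 3) ^ n = ((1 / real b) ^ n) powr ?s"
  proof -
    have "((1 / real b) ^ n) powr ?s = ((1 / real b) powr ?s) ^ n"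
      using b by (simp add: powr_power powr_realpow[symmetric] powr_powr mult.commute)
    also have "(1 / real b) powr ?s = 1 / 3" using b powr_log_base_3 by (simp add: powr_divide)
    finally show ?thesis by simp
  qed
  also have "\<dots> \<le> ?t powr ?s" using n log_base_3 b by (intro powr_mono2) auto
  also have "\<dots> = 3 powr ?s * \<bar>x - y\<bar> powr ?s" by (simp add: powr_mult)
  also have "\<dots> \<le> 3 powr 1 * \<bar>x - y\<bar> powr ?s"
    using log_base_3 by (intro mult_right_mono powr_mono) auto
  finally show ?thesis using pq by simp
qed

text \<open>For a cover by sets \<open>U i\<close>, the base-\<open>3\<close> images of the \<open>U i\<close> cover \<open>[0, 1]\<close>, and each is contained in an
  interval of length \<open>18 * diameter (U i) powr log b 3\<close>. Comparing Lebesgue measures bounds the sum of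
  the gauges from below.\<close>

lemma seam_premeasure_lower:
  assumes s: "0 \<le> s" "s \<le> log (real b) 3" and sub: "seam b \<subseteq> A"
  shows "ennreal (1 / 18) \<le> hausdorff_premeasure s 1 A"
  unfolding hausdorff_premeasure_def
proof (rule INF_greatest)
  let ?s = "log (real b) 3"
  fix U :: "nat \<Rightarrow> real set"
  assume "U \<in> {U. A \<subseteq> (\<Union>i. U i) \<and> (\<forall>i. bounded (U i) \<and> diameter (U i) \<le> 1)}"
  then have cov: "seam b \<subseteq> (\<Union>i. U i)" and bdd: "\<And>i. bounded (U i)" and dia: "\<And>i. diameter (U i) \<le> 1"
    using sub by auto
  have "\<exists>c. \<forall>x\<in>U i. \<forall>p. matched x p \<longrightarrow> p \<in> cball c (9 * diameter (U i) powr ?s)" for i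
  proof (cases "\<exists>x\<in>U i. \<exists>p. matched x p")
    case True
    then obtain y c where y: "y \<in> U i" "matched y c" by blast
    have "p \<in> cball c (9 * diameter (U i) powr ?s)" if x: "x \<in> U i" "matched x p" for x p
    proof -
      have "\<bar>y - x\<bar> \<le> diameter (U i)"
        using diameter_bounded_bound[OF bdd[of i] y(1) x(1)] by (simp add: dist_real_def)
      then have "\<bar>y - x\<bar> powr ?s \<le> diameter (U i) powr ?s"
        using log_base_3 by (intro powr_mono2) auto
      then show ?thesis using matched_hoelder[OF y(2) x(2)] by (simp add: dist_real_def)
    qed
    then show ?thesis by blast
  qed auto
  then obtain c where c: "\<And>i x p. x \<in> U i \<Longrightarrow> matched x p \<Longrightarrow> p \<in> cball (c i) (9 * diameter (U i) powr ?s)"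
    by metis
  define V where "V i = (if U i = {} then {} else cball (c i) (9 * diameter (U i) powr ?s))" for i
  have V: "emeasure lborel (V i) \<le> 18 * diam_gauge s (U i)" for i
  proof (cases "U i = {}")
    case False
    have d0: "diameter (U i) \<ge> 0" using diameter_ge_0[OF bdd] .
    have "diameter (U i) powr ?s \<le> diameter (U i) powr s"
      using d0 dia[of i] s by (intro powr_mono') auto
    moreover have "diameter (U i) powr s \<le> 1"
      using d0 dia[of i] s by (intro powr_le1) auto
    ultimately have "diameter (U i) powr ?s \<le> (if s = 0 then 1 else diameter (U i) powr s)"
      by auto
    then have "ennreal (18 * diameter (U i) powr ?s) \<le> ennreal (18 * (if s = 0 then 1 else diameter (U i) powr s))"
      by (intro ennreal_leI mult_left_mono) auto
    also have "\<dots> = 18 * diam_gauge s (U i)"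
      using False by (simp add: diam_gauge_def ennreal_mult)
    finally show ?thesis using False by (simp add: V_def cball_eq_atLeastAtMost)
  qed (simp add: V_def)
  have "{0..1} \<subseteq> (\<Union>i. V i)"
  proof
    fix p :: real assume "p \<in> {0..1}"
    then obtain x where x: "matched x p" using matched_surj by auto
    then obtain i where "x \<in> U i" using matched_bounds(1)[OF x] cov by blast
    then show "p \<in> (\<Union>i. V i)" using c[OF _ x] by (auto simp: V_def)
  qed
  then have "emeasure lborel {0..1::real} \<le> emeasure lborel (\<Union>i. V i)"
    by (intro emeasure_mono) (auto simp: V_def)
  also have "\<dots> \<le> (\<Sum>i. emeasure lborel (V i))"
    by (intro emeasure_subadditive_countably) (auto simp: V_def)
  also have "\<dots> \<le> (\<Sum>i. 18 * diam_gauge s (U i))" using V by (intro suminf_le) auto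
  also have "\<dots> = 18 * (\<Sum>i. diam_gauge s (U i))" by simp
  finally have "1 \<le> 18 * (\<Sum>i. diam_gauge s (U i))" by simp
  then have "ennreal (1/18) * 1 \<le> ennreal (1/18) * (ennreal 18 * (\<Sum>i. diam_gauge s (U i)))"
    by (intro mult_left_mono) simp_all
  also have "\<dots> = (ennreal (1/18) * ennreal 18) * (\<Sum>i. diam_gauge s (U i))" by (simp add: mult.assoc)
  also have "ennreal (1/18) * ennreal 18 = 1" by (subst ennreal_mult[symmetric]) auto
  finally show "ennreal (1/18) \<le> (\<Sum>i. diam_gauge s (U i))" by simp
qed

lemma hausdorff_dim_seams:
  "hausdorff_dim (seam b \<union> (+) 1 ` seam b) = ennreal (log (real b) 3)"
proof (rule hausdorff_dim_eqI)
  fix s assume "0 \<le> s" "s \<le> log (real b) 3"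
  then have "ennreal (1 / 18) \<le> hausdorff_premeasure s 1 (seam b \<union> (+) 1 ` seam b)"
    by (rule seam_premeasure_lower) simp
  also have "\<dots> \<le> hausdorff_measure s (seam b \<union> (+) 1 ` seam b)"
    unfolding hausdorff_measure_def by (rule SUP_upper) simp
  finally show "hausdorff_measure s (seam b \<union> (+) 1 ` seam b) \<noteq> 0"
    by (auto simp: ennreal_eq_0_iff)
qed (use log_base_3 seams_measure_zero in auto)

lemma log_base_3_notin_Ints: "log (real b) 3 \<notin> \<int>"
  using log_base_3 by (auto elim!: Ints_cases)

end

section \<open>Coding by symbol sequences and the Cantor set\<close>

text \<open>A compact set that is the disjoint union of its images under finitely many injective contractions
  is homeomorphic to the space of sequences over the index set: a point is coded by its itinerary
  under the inverse branches.\<close>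

lemma disjoint_ifs_homeomorphic:
  fixes K :: "real set" and f :: "'i :: metric_space \<Rightarrow> real \<Rightarrow> real"
  assumes K: "compact K" "K \<noteq> {}" and D: "finite D"
    and eq: "K = (\<Union>d\<in>D. f d ` K)"
    and disj: "\<And>d e. d \<in> D \<Longrightarrow> e \<in> D \<Longrightarrow> d \<noteq> e \<Longrightarrow> f d ` K \<inter> f e ` K = {}"
    and cont: "\<And>d. d \<in> D \<Longrightarrow> continuous_on K (f d)"
    and inj: "\<And>d. d \<in> D \<Longrightarrow> inj_on (f d) K"
    and contr: "\<And>d x y. d \<in> D \<Longrightarrow> x \<in> K \<Longrightarrow> y \<in> K \<Longrightarrow> \<bar>f d x - f d y\<bar> \<le> \<rho> * \<bar>x - y\<bar>"
    and \<rho>: "0 \<le> \<rho>" "\<rho> < 1"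
  shows "K homeomorphic PiE (UNIV :: nat set) (\<lambda>_. D)"
proof -
  have "\<forall>x\<in>K. \<exists>d\<in>D. \<exists>y\<in>K. x = f d y" using eq by blast
  \<comment> \<open>\<open>dg\<close> reads off the leading symbol of a point and \<open>sg\<close> is the shift.\<close>
  then obtain dg sg where ds: "\<And>x. x \<in> K \<Longrightarrow> dg x \<in> D \<and> sg x \<in> K \<and> x = f (dg x) (sg x)"
    by metis
  have dgD: "dg x \<in> D" and sgK: "sg x \<in> K" if "x \<in> K" for x using ds[OF that] by blast+
  have fK: "f d y \<in> K" if "d \<in> D" "y \<in> K" for d y using eq that by blast
  have ds_f: "dg (f d y) = d" "sg (f d y) = y" if "d \<in> D" "y \<in> K" for d y
  proof -
    let ?x = "f d y"
    have x: "dg ?x \<in> D" "sg ?x \<in> K" "?x = f (dg ?x) (sg ?x)" using ds[OF fK[OF that]] by blast+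
    then have "?x \<in> f d ` K \<inter> f (dg ?x) ` K" using that by blast
    then show "dg ?x = d" using disj[OF that(1) x(1)] by (cases "d = dg ?x") auto
    then have "f d y = f d (sg ?x)" using x(3) by simp
    then show "sg ?x = y" using x(2) inj_onD[OF inj[OF that(1)]] that(2) by metis
  qed
  have pieces: "compact (f d ` K)" if "d \<in> D" for d
    using K(1) cont[OF that] by (rule compact_continuous_image[rotated])
  have "continuous_on (\<Union>d\<in>D. f d ` K) dg"
  proof (rule continuous_on_closed_Union[OF D])
    fix d assume d: "d \<in> D"
    show "closed (f d ` K)" using pieces[OF d] by (rule compact_imp_closed)
    have "continuous_on (f d ` K) (\<lambda>_. d)" by simp
    then show "continuous_on (f d ` K) dg"
      by (rule continuous_on_eq) (use ds_f d in auto)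
  qed
  then have dg: "continuous_on K dg" using eq by simp
  have "continuous_on (\<Union>d\<in>D. f d ` K) sg"
  proof (rule continuous_on_closed_Union[OF D])
    fix d assume d: "d \<in> D"
    show "closed (f d ` K)" using pieces[OF d] by (rule compact_imp_closed)
    show "continuous_on (f d ` K) sg"
      using cont[OF d] K(1) by (rule continuous_on_inv) (use ds_f d in auto)
  qed
  then have sg: "continuous_on K sg" using eq by simp
  define it where "it n = sg ^^ n" for n
  have itK: "it n x \<in> K" if "x \<in> K" for n x
    by (induction n) (use sgK that in \<open>auto simp: it_def\<close>)
  have it: "continuous_on K (it n)" for n
  proof (induction n)
    case (Suc n)
    have "continuous_on K (\<lambda>x. sg (it n x))"
      using itK by (intro continuous_on_compose2[OF sg Suc.IH]) auto
    moreover have "it (Suc n) = (\<lambda>x. sg (it n x))" by (auto simp: it_def)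
    ultimately show ?case by simp
  qed (simp add: it_def)
  define code where "code x n = dg (it n x)" for x n
  have code_Suc: "code x (Suc n) = code (sg x) n" for x n
    unfolding code_def it_def by (simp only: funpow_Suc_right o_def)
  have "continuous_on K (\<lambda>x. code x n)" for n
    unfolding code_def using itK by (intro continuous_on_compose2[OF dg it]) auto
  then have code_cont: "continuous_on K code"
    by (rule continuous_on_coordinatewise_then_product)
  have code_D: "code x n \<in> D" if "x \<in> K" for x n using dgD itK[OF that] by (simp add: code_def)
  obtain B where B: "\<And>x y. x \<in> K \<Longrightarrow> y \<in> K \<Longrightarrow> \<bar>x - y\<bar> \<le> B"
    using diameter_bounded_bound[OF compact_imp_bounded[OF K(1)]] by (metis dist_real_def)
  have close: "\<bar>x - y\<bar> \<le> \<rho> ^ n * B" if "x \<in> K" "y \<in> K" "code x = code y" for x y n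
    using that
  proof (induction n arbitrary: x y)
    case 0
    then show ?case using B by simp
  next
    case (Suc n)
    have d: "dg x = dg y" using fun_cong[OF Suc.prems(3), of 0] by (simp add: code_def it_def)
    have "code (sg x) = code (sg y)"
      using Suc.prems(3) by (metis code_Suc ext)
    then have IH: "\<bar>sg x - sg y\<bar> \<le> \<rho> ^ n * B" using Suc sgK by blast
    have "\<bar>x - y\<bar> = \<bar>f (dg x) (sg x) - f (dg x) (sg y)\<bar>" using ds Suc.prems d by metis
    also have "\<dots> \<le> \<rho> * \<bar>sg x - sg y\<bar>" using contr dgD sgK Suc.prems by blast
    also have "\<dots> \<le> \<rho> * (\<rho> ^ n * B)" using IH \<rho>(1) by (rule mult_left_mono)
    finally show ?case by (simp add: mult.assoc)
  qed
  have code_inj: "inj_on code K"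
  proof (rule inj_onI)
    fix x y assume xy: "x \<in> K" "y \<in> K" "code x = code y"
    have "(\<lambda>n. \<rho> ^ n * B) \<longlonglongrightarrow> 0 * B" using \<rho> by (intro tendsto_mult LIMSEQ_power_zero tendsto_const) auto
    then have "\<bar>x - y\<bar> \<le> 0" using close[OF xy] by (intro LIMSEQ_le_const) auto
    then show "x = y" by simp
  qed
  \<comment> \<open>\<open>cyl n t\<close> is the set of points whose itinerary starts with \<open>t 0, ..., t (n - 1)\<close>; a point in the
    intersection of these nested compact sets has itinerary \<open>t\<close>.\<close>
  define cyl where "cyl = rec_nat (\<lambda>t. K) (\<lambda>n C t. f (t 0) ` C (\<lambda>i. t (Suc i)))"
  have cyl0: "cyl 0 t = K" and cylS: "cyl (Suc n) t = f (t 0) ` cyl n (\<lambda>i. t (Suc i))" for n t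
    by (simp_all add: cyl_def)
  have cylK: "cyl n t \<subseteq> K \<and> cyl n t \<noteq> {} \<and> compact (cyl n t) \<and> cyl (Suc n) t \<subseteq> cyl n t"
    if "\<And>i. t i \<in> D" for n t
    using that
  proof (induction n arbitrary: t)
    case 0
    then show ?case using K pieces fK by (auto simp: cyl0 cylS)
  next
    case (Suc n)
    let ?t = "\<lambda>i. t (Suc i)"
    have IH: "cyl n ?t \<subseteq> K" "cyl n ?t \<noteq> {}" "compact (cyl n ?t)" "cyl (Suc n) ?t \<subseteq> cyl n ?t"
      using Suc.IH[of ?t] Suc.prems by blast+
    have "compact (cyl (Suc n) t)" unfolding cylS
      using cont[OF Suc.prems] IH by (intro compact_continuous_image) (auto intro: continuous_on_subset)
    moreover have "cyl (Suc n) t \<subseteq> K" "cyl (Suc n) t \<noteq> {}"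
      unfolding cylS using IH fK Suc.prems by blast+
    moreover have "cyl (Suc (Suc n)) t \<subseteq> cyl (Suc n) t"
      using IH(4) unfolding cylS[of "Suc n" t] cylS[of n t] by (rule image_mono)
    ultimately show ?case by blast
  qed
  have code_cyl: "code x i = t i" if "\<And>i. t i \<in> D" "x \<in> cyl n t" "i < n" for x i n t
    using that
  proof (induction n arbitrary: x i t)
    case (Suc n)
    let ?t = "\<lambda>i. t (Suc i)"
    obtain y where y: "y \<in> cyl n ?t" "x = f (t 0) y" using Suc.prems(2) unfolding cylS by blast
    have "y \<in> K" using y(1) cylK[of ?t n] Suc.prems(1) by blast
    then have x: "dg x = t 0" "sg x = y" using ds_f Suc.prems(1) y(2) by auto
    show ?case
    proof (cases i)
      case 0
      then show ?thesis using x by (simp add: code_def it_def)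
    next
      case (Suc j)
      then show ?thesis using Suc.IH[of ?t y j] Suc.prems y(1) x by (simp add: code_Suc)
    qed
  qed simp
  have img: "code ` K = PiE UNIV (\<lambda>_. D)"
  proof
    show "code ` K \<subseteq> PiE UNIV (\<lambda>_. D)" using code_D by auto
    show "PiE UNIV (\<lambda>_. D) \<subseteq> code ` K"
    proof
      fix t :: "nat \<Rightarrow> 'i" assume "t \<in> PiE UNIV (\<lambda>_. D)"
      then have t: "\<And>i. t i \<in> D" by auto
      have c: "cyl n t \<noteq> {}" "compact (cyl n t)" "cyl (Suc n) t \<subseteq> cyl n t" for n
        using cylK[of t n, OF t] by blast+
      have "(\<Inter>n. cyl n t) \<noteq> {}"
        using c(2,1) lift_Suc_antimono_le[of "\<lambda>n. cyl n t", OF c(3)] by (rule compact_nest)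
      then obtain x where x: "\<And>n. x \<in> cyl n t" by blast
      have "code x = t" using code_cyl[of t, OF t x] by blast
      moreover have "x \<in> K" using x[of 0] by (simp add: cyl0)
      ultimately show "t \<in> code ` K" by blast
    qed
  qed
  show ?thesis
    by (rule homeomorphic_compact[OF K(1) code_cont img code_inj])
qed

context
  fixes b :: nat
  assumes b: "b \<ge> 4"
begin

lemma seam_homeomorphic_sequences: "seam b homeomorphic PiE (UNIV :: nat set) (\<lambda>_. {0, 1, 2 :: real})"
proof (rule disjoint_ifs_homeomorphic)
  let ?f = "\<lambda>d x. (d + x) / real b"
  show "seam b = (\<Union>d\<in>{0, 1, 2}. ?f d ` seam b)" using seam_eq[OF b] by simp
  show "seam b \<noteq> {}" using zero_in_seam[OF b] by auto
  show "?f d ` seam b \<inter> ?f e ` seam b = {}" if "d \<in> {0, 1, 2}" "e \<in> {0, 1, 2}" "d \<noteq> e" for d e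
  proof (rule ccontr)
    assume "?f d ` seam b \<inter> ?f e ` seam b \<noteq> {}"
    then obtain x y where xy: "x \<in> seam b" "y \<in> seam b" "?f d x = ?f e y" by blast
    then have "d + x = e + y" using b by simp
    then have "\<bar>d - e\<bar> < 1" using seam_bounds[OF b xy(1)] seam_bounds[OF b xy(2)] by linarith
    then show False using that by auto
  qed
  show "continuous_on (seam b) (?f d)" for d using b by (intro continuous_intros) auto
  show "inj_on (?f d) (seam b)" for d using b by (auto intro: inj_onI)
  show "\<bar>?f d x - ?f d y\<bar> \<le> 1 / 4 * \<bar>x - y\<bar>" for d x y
  proof -
    have "?f d x - ?f d y = (x - y) / real b" by (simp add: diff_divide_distrib[symmetric])
    then have "\<bar>?f d x - ?f d y\<bar> = 1 / real b * \<bar>x - y\<bar>" by simp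
    also have "\<dots> \<le> 1 / 4 * \<bar>x - y\<bar>" using b by (intro mult_right_mono) (auto simp: divide_simps)
    finally show ?thesis .
  qed
qed (use compact_seam[OF b] in auto)

end

lemma cantor_ternary_facts:
  shows cantor_ternary_eq: "cantor_ternary_set = (\<lambda>x. x / 3) ` cantor_ternary_set \<union> (\<lambda>x. (2 + x) / 3) ` cantor_ternary_set"
    and compact_cantor_ternary: "compact cantor_ternary_set"
    and zero_in_cantor_ternary: "0 \<in> cantor_ternary_set"
    and cantor_ternary_bounds: "cantor_ternary_set \<subseteq> {0..1}"
proof -
  have D: "{0, 2} \<subseteq> {..2 :: nat}" by auto
  have b: "3 \<ge> (2 :: nat)" by simp
  show "cantor_ternary_set = (\<lambda>x. x / 3) ` cantor_ternary_set \<union> (\<lambda>x. (2 + x) / 3) ` cantor_ternary_set"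
    using radix_set_eq[OF b D] by (simp add: cantor_ternary_set_def)
  show "compact cantor_ternary_set" using compact_radix_set[OF b D] by (simp add: cantor_ternary_set_def)
  show "0 \<in> cantor_ternary_set" using zero_in_radix_set[OF b D] by (simp add: cantor_ternary_set_def)
  show "cantor_ternary_set \<subseteq> {0..1}" using radix_set_bounds[OF b D] by (force simp: cantor_ternary_set_def)
qed

text \<open>The ternary Cantor set \<open>K\<close> is also a disjoint union of three contracted copies of itself, obtained
  by splitting the right half of \<open>K = K / 3 \<union> (2 + K) / 3\<close> once more.\<close>

lemma cantor_homeomorphic_sequences:
  "cantor_ternary_set homeomorphic PiE (UNIV :: nat set) (\<lambda>_. {0, 1, 2 :: real})"
proof (rule disjoint_ifs_homeomorphic)
  let ?K = "cantor_ternary_set"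
  define a where "a d = (if d = 0 then 0 else if d = 1 then 6 else (8 :: real))" for d :: real
  define r where "r d = (if d = 0 then 3 else (9 :: real))" for d :: real
  let ?f = "\<lambda>d x. (a d + x) / r d"
  have r: "r d \<ge> 3" for d by (simp add: r_def)
  have ar [simp]: "a 0 = 0" "a 1 = 6" "a 2 = 8" "r 0 = 3" "r 1 = 9" "r 2 = 9"
    by (simp_all add: a_def r_def)
  have "?K = (\<lambda>x. x / 3) ` ?K \<union> (\<lambda>x. (2 + x) / 3) ` ((\<lambda>x. x / 3) ` ?K \<union> (\<lambda>x. (2 + x) / 3) ` ?K)"
    using cantor_ternary_eq by simp
  also have "\<dots> = ?f 0 ` ?K \<union> ?f 1 ` ?K \<union> ?f 2 ` ?K"
    by (simp add: image_Un image_image Un_assoc add_divide_distrib)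
  finally show "?K = (\<Union>d\<in>{0, 1, 2}. ?f d ` ?K)" by auto
  show "?K \<noteq> {}" using zero_in_cantor_ternary by blast
  show "?f d ` ?K \<inter> ?f e ` ?K = {}" if "d \<in> {0, 1, 2}" "e \<in> {0, 1, 2}" "d \<noteq> e" for d e
  proof (rule ccontr)
    assume "?f d ` ?K \<inter> ?f e ` ?K \<noteq> {}"
    then obtain x y where "x \<in> ?K" "y \<in> ?K" and eq: "?f d x = ?f e y" by blast
    then have "0 \<le> x" "x \<le> 1" "0 \<le> y" "y \<le> 1" using cantor_ternary_bounds by auto
    then show False using that eq by (elim insertE emptyE) simp_all
  qed
  show "continuous_on ?K (?f d)" for d using r[of d] by (intro continuous_intros) auto
  show "inj_on (?f d) ?K" for d using r[of d] by (auto intro: inj_onI)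
  show "\<bar>?f d x - ?f d y\<bar> \<le> 1 / 3 * \<bar>x - y\<bar>" for d x y
  proof -
    have "?f d x - ?f d y = (x - y) / r d" by (simp add: diff_divide_distrib[symmetric])
    then have "\<bar>?f d x - ?f d y\<bar> = 1 / r d * \<bar>x - y\<bar>" using r[of d] by simp
    also have "\<dots> \<le> 1 / 3 * \<bar>x - y\<bar>" using r[of d] by (intro mult_right_mono) (auto simp: divide_simps)
    finally show ?thesis .
  qed
qed (use compact_cantor_ternary in auto)

text \<open>Each of the two seams is homeomorphic to \<open>K\<close>. They are placed on the two halves of
  \<open>K = K / 3 \<union> (2 + K) / 3\<close>.\<close>

lemma is_cantor_set_seams:
  assumes b: "b \<ge> 4"
  shows "is_cantor_set (seam b \<union> (+) 1 ` seam b)"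
proof -
  let ?K = "cantor_ternary_set" and ?S = "seam b \<union> (+) 1 ` seam b"
  have "seam b homeomorphic ?K"
    using seam_homeomorphic_sequences[OF b] cantor_homeomorphic_sequences
    by (meson homeomorphic_sym homeomorphic_trans)
  then obtain g g' where g: "homeomorphism (seam b) ?K g g'" unfolding homeomorphic_def by blast
  then have g_img: "g ` seam b = ?K" and g_cont: "continuous_on (seam b) g" and g_inj: "inj_on g (seam b)"
    by (auto simp: homeomorphism_def intro: inj_on_inverseI)
  \<comment> \<open>The threshold \<open>5 / 6\<close> separates \<open>seam b\<close>, contained in \<open>[0, 2 / 3]\<close>, from its translate by \<open>1\<close>.\<close>
  define h where "h x = (if x < 5 / 6 then g x / 3 else (2 + g (x - 1)) / 3)" for x
  have h1: "h x = g x / 3" "h (1 + x) = (2 + g x) / 3" if "x \<in> seam b" for x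
    using seam_bounds[OF b that] by (auto simp: h_def)
  have comp: "compact (seam b)" "compact ((+) 1 ` seam b)"
    using compact_seam[OF b] by (auto simp: compact_translation)
  have "continuous_on (seam b) (\<lambda>x. g x / 3)" using g_cont by (intro continuous_intros) auto
  then have c1: "continuous_on (seam b) h" by (rule continuous_on_eq) (simp add: h1)
  have "continuous_on ((+) 1 ` seam b) (\<lambda>x. g (x - 1))"
    by (rule continuous_on_compose2[OF g_cont]) (auto intro!: continuous_intros)
  then have "continuous_on ((+) 1 ` seam b) (\<lambda>x. (2 + g (x - 1)) / 3)"
    by (intro continuous_intros) auto
  then have c2: "continuous_on ((+) 1 ` seam b) h" by (rule continuous_on_eq) (auto simp: h1)
  have cont: "continuous_on ?S h"
    using c1 c2 comp by (intro continuous_on_closed_Un) (auto intro: compact_imp_closed)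
  have "h ` ?S = (\<lambda>x. x / 3) ` g ` seam b \<union> (\<lambda>x. (2 + x) / 3) ` g ` seam b"
    unfolding image_Un image_image by (simp add: h1 cong: image_cong)
  also have "\<dots> = ?K" unfolding g_img by (rule cantor_ternary_eq[symmetric])
  finally have img: "h ` ?S = ?K" .
  have gb: "0 \<le> g x" "g x \<le> 1" if "x \<in> seam b" for x
    using that g_img cantor_ternary_bounds by fastforce+
  have "inj_on h ?S"
  proof (rule inj_onI)
    fix x y assume "x \<in> ?S" "y \<in> ?S" and eq: "h x = h y"
    then consider u v where "u \<in> seam b" "v \<in> seam b" "x = u" "y = v"
      | u v where "u \<in> seam b" "v \<in> seam b" "x = 1 + u" "y = 1 + v"
      | u v where "u \<in> seam b" "v \<in> seam b" "x = u" "y = 1 + v"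
      | u v where "u \<in> seam b" "v \<in> seam b" "x = 1 + u" "y = v"
      by blast
    then show "x = y"
    proof cases
      case 1
      then show ?thesis using eq h1 inj_onD[OF g_inj, of u v] by simp
    next
      case 2
      then show ?thesis using eq h1 inj_onD[OF g_inj, of u v] by simp
    next
      case 3
      then show ?thesis using eq h1(1)[of u] h1(2)[of v] gb[of u] gb[of v] by simp
    next
      case 4
      then show ?thesis using eq h1(2)[of u] h1(1)[of v] gb[of u] gb[of v] by simp
    qed
  qed
  then have "?S homeomorphic ?K"
    using homeomorphic_compact[OF _ cont img] comp by blast
  then show ?thesis by (simp add: is_cantor_set_def)
qed

section \<open>Components of the interior\<close>

lemma open_connected_bounded_real:
  fixes S :: "real set"
  assumes "open S" "connected S" "bounded S" "S \<noteq> {}"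
  shows "\<exists>a b. a < b \<and> S = {a<..<b}"
proof -
  have bdd: "bdd_below S" "bdd_above S"
    using assms(3) by (auto intro: bounded_imp_bdd_below bounded_imp_bdd_above)
  have ni: "Inf S \<notin> S" "Sup S \<notin> S"
  proof -
    obtain B where "\<And>x. x \<in> S \<Longrightarrow> \<bar>x\<bar> \<le> B" using assms(3) by (auto simp: bounded_iff)
    then have "\<forall>x\<in>S. - B - 1 < x" "\<forall>x\<in>S. x < B + 1" by fastforce+
    then show "Inf S \<notin> S" "Sup S \<notin> S"
      using Inf_notin_open Sup_notin_open assms(1) by blast+
  qed
  have "S = {Inf S<..<Sup S}"
  proof
    show "S \<subseteq> {Inf S<..<Sup S}"
    proof
      fix x assume "x \<in> S"
      then have "Inf S \<le> x" "x \<le> Sup S" using bdd by (auto intro: cInf_lower cSup_upper)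
      moreover have "x \<noteq> Inf S" "x \<noteq> Sup S" using ni \<open>x \<in> S\<close> by auto
      ultimately show "x \<in> {Inf S<..<Sup S}" by auto
    qed
    show "{Inf S<..<Sup S} \<subseteq> S"
    proof
      fix x assume "x \<in> {Inf S<..<Sup S}"
      then obtain y z where "y \<in> S" "y < x" "z \<in> S" "x < z"
        using cInf_less_iff[OF assms(4) bdd(1)] less_cSup_iff[OF assms(4) bdd(2)] by auto
      then show "x \<in> S" using assms(2) by (meson connectedD_interval less_imp_le)
    qed
  qed
  then show ?thesis using assms(4) by (metis greaterThanLessThan_empty_iff linorder_not_le)
qed

text \<open>If there were only finitely many components, the boundary of a regular closed set would consist of
  their endpoints only.\<close>

lemma interior_infinite_union_of_intervals:
  fixes S :: "real set"
  assumes S: "compact S" "S \<subseteq> closure (interior S)" and fr: "infinite (frontier S)"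
  shows "\<exists>\<U>. infinite \<U> \<and> pairwise disjnt \<U>
    \<and> (\<forall>U\<in>\<U>. \<exists>a b. a < b \<and> U = {a<..<b}) \<and> interior S = \<Union>\<U>"
proof -
  let ?I = "interior S"
  let ?U = "components ?I"
  have ints: "\<exists>a b. a < b \<and> U = {a<..<b}" if U: "U \<in> ?U" for U
  proof (rule open_connected_bounded_real)
    show "open U" using U by (rule open_components[OF open_interior])
    show "connected U" using U by (rule in_components_connected)
    show "U \<noteq> {}" using U by (rule in_components_nonempty)
    show "bounded U" using in_components_subset[OF U] interior_subset compact_imp_bounded[OF S(1)]
      by (meson bounded_subset)
  qed
  have "pairwise disjnt ?U" using pairwise_disjoint_components by (simp add: disjnt_def pairwise_def)
  moreover have "infinite ?U"
  proof
    assume fin: "finite ?U"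
    have "frontier S \<subseteq> (\<Union>U\<in>?U. closure U - U)"
    proof
      fix x assume x: "x \<in> frontier S"
      then have "x \<in> S" "x \<notin> ?I"
        using closure_closed[OF compact_imp_closed[OF S(1)]] by (auto simp: frontier_def)
      then have "x \<in> closure ?I" using S(2) by blast
      moreover note \<open>x \<notin> ?I\<close>
      moreover have "closure ?I \<subseteq> (\<Union>U\<in>?U. closure U)"
      proof (rule closure_minimal)
        show "?I \<subseteq> (\<Union>U\<in>?U. closure U)"
          using Union_components[of ?I] closure_subset by blast
        show "closed (\<Union>U\<in>?U. closure U)" using fin by (intro closed_UN) auto
      qed
      ultimately show "x \<in> (\<Union>U\<in>?U. closure U - U)" using Union_components[of ?I] by blast
    qed
    moreover have "finite (closure U - U)" if "U \<in> ?U" for U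
    proof -
      have "\<exists>a b. a < b \<and> U = {a<..<b}" using that by (rule ints)
      then obtain a b where ab: "a < b" "U = {a<..<b}" by blast
      then have "closure U - U \<subseteq> {a, b}" by auto
      then show ?thesis by (rule finite_subset) simp
    qed
    ultimately have "finite (frontier S)" using fin by (meson finite_UN_I finite_subset)
    then show False using fr by blast
  qed
  moreover have "?I = \<Union>?U" by (rule Union_components[symmetric])
  ultimately show ?thesis using ints by (intro exI[of _ ?U]) blast
qed

lemma infinite_seam:
  assumes b: "b \<ge> 4"
  shows "infinite (seam b)"
proof -
  have "(1 / real b) ^ Suc n \<in> seam b" for n
  proof (induction n)
    case 0
    have "0 \<in> seam b" using zero_in_seam[OF b] by simp
    then show ?case using seam_consI[OF b, of 1 0] by simp
  next
    case (Suc n)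
    then show ?case using seam_consI[OF b, of 0 "(1 / real b) ^ Suc n"] by simp
  qed
  then have "range (\<lambda>n. (1 / real b) ^ Suc n) \<subseteq> seam b" by blast
  moreover have "inj (\<lambda>n. (1 / real b) ^ Suc n)"
    using b by (auto intro!: injI simp: power_inject_exp' simp del: power_Suc dest: power_inject_exp)
  ultimately show ?thesis using range_inj_infinite infinite_super by blast
qed

section \<open>The decomposition theorem\<close>

theorem corollary3:
  fixes m :: nat
  assumes "m \<ge> 1"
  shows "X m = X_I m \<union> X_C m \<and> X_I m \<inter> X_C m = {}
    \<and> (\<exists>\<U>. infinite \<U> \<and> pairwise disjnt \<U>
           \<and> (\<forall>U\<in>\<U>. \<exists>a b. a < b \<and> U = {a<..<b}) \<and> X_I m = \<Union>\<U>)
    \<and> emeasure lebesgue (X_I m) = 1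
    \<and> is_cantor_set (X_C m)
    \<and> emeasure lebesgue (X_C m) = 0
    \<and> hausdorff_dim (X_C m) = ennreal (log (real (2 * m + 2)) 3)
    \<and> log (real (2 * m + 2)) 3 \<notin> \<int>"
proof -
  define b where "b = 2 * m + 2"
  have b: "b \<ge> 4" using assms by (simp add: b_def)
  have "tile_digits b = {0} \<union> {2..2 * m + 1} \<union> {2 * m + 3}" by (auto simp: tile_digits_def b_def)
  then have X: "X m = tile b" by (simp add: X_def tile_def b_def)
  have I: "X_I m = interior (tile b)" and C: "X_C m = frontier (tile b)"
    by (simp_all add: X_I_def X_C_def X)
  have seams: "X_C m = seam b \<union> (+) 1 ` seam b" unfolding C by (rule frontier_tile[OF b])
  have "closed (tile b)" using compact_tile[OF b] by (rule compact_imp_closed)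
  then have "X m = X_I m \<union> X_C m" "X_I m \<inter> X_C m = {}"
    unfolding X I C using interior_subset by (auto simp: frontier_def)
  moreover have "infinite (frontier (tile b))"
    using infinite_seam[OF b] frontier_tile[OF b] by simp
  then have "\<exists>\<U>. infinite \<U> \<and> pairwise disjnt \<U>
           \<and> (\<forall>U\<in>\<U>. \<exists>a b. a < b \<and> U = {a<..<b}) \<and> X_I m = \<Union>\<U>"
    unfolding I by (rule interior_infinite_union_of_intervals[OF compact_tile[OF b] tile_subset_closure_interior[OF b]])
  moreover have "emeasure lebesgue (X_I m) = 1" unfolding I by (rule measure_interior_tile[OF b])
  moreover have "emeasure lebesgue (X_C m) = 0"
    unfolding C using frontier_tile_null[OF b] by (rule null_setsD1)
  moreover have "is_cantor_set (X_C m)" unfolding seams by (rule is_cantor_set_seams[OF b])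
  moreover have "hausdorff_dim (X_C m) = ennreal (log (real (2 * m + 2)) 3)"
    unfolding seams using hausdorff_dim_seams[OF b] by (simp only: b_def)
  moreover have "log (real (2 * m + 2)) 3 \<notin> \<int>"
    using log_base_3_notin_Ints[OF b] unfolding b_def .
  ultimately show ?thesis by blast
qed

end
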